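(* If the Collatz sequence of every odd positive integer divisible by $3$ converges to $1$, then the Collatz sequence of every positive integer converges to $1$.
   Context: For a positive integer $A$, the Collatz sequence of $A$ (with starting number $A$) is the sequence $(c_i)_{i\ge 0}$ with $c_0=A$ and, for $i\ge 1$, $c_i=3c_{i-1}+1$ if $c_{i-1}$ is odd and $c_i=c_{i-1}/2$ if $c_{i-1}$ is even. It is said to converge to $1$ if $c_i=1$ for some $i$. *)

theory Defs
  imports Main
begin

primrec collatz :: "nat \<Rightarrow> nat \<Rightarrow> nat" where
  "collatz A 0 = A"
| "collatz A (Suc i) =
     (if odd (collatz A i) then 3 * collatz A i + 1 else collatz A i div 2)"

definition converges_to_1 :: "(nat \<Rightarrow> nat) \<Rightarrow> bool" where
  "converges_to_1 c \<longleftrightarrow> (\<exists>i. c i = 1)"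

end

(* The number 2 is a primitive root modulo 9. So if 3 does not divide A, some 2^k * A with k >= 1 is
   of the form 9 q + 1; it is even, hence q is odd, and it is the Collatz successor 3 B + 1 of the odd
   multiple B = 3 q of 3. Thus B reaches A. If 3 divides A, halving leads to an odd multiple of 3. *)
theory Submission
  imports Defs
begin

lemma collatz_shift: "collatz A (Suc i) = collatz (collatz A 1) i"
  by (induction i) auto

text \<open>Convergence can thus be carried along the sequence both ways: forwards from
  \<open>3 * q\<close> to its successor, backwards from a half to its double.\<close>

lemma converges_to_1_collatz_step:
  "converges_to_1 (collatz (collatz A 1)) \<longleftrightarrow> converges_to_1 (collatz A)"
proof
  assume "converges_to_1 (collatz (collatz A 1))"
  then show "converges_to_1 (collatz A)"
    unfolding converges_to_1_def by (metis collatz_shift)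
next
  assume "converges_to_1 (collatz A)"
  then obtain i where i: "collatz A i = 1"
    unfolding converges_to_1_def by blast
  show "converges_to_1 (collatz (collatz A 1))"
  proof (cases i)
    case 0
    \<comment> \<open>The cycle 1, 4, 2, 1 returns to 1.\<close>
    then have "collatz (collatz A 1) (Suc (Suc 0)) = 1"
      using i by simp
    then show ?thesis
      unfolding converges_to_1_def by blast
  next
    case (Suc j)
    then show ?thesis
      using i collatz_shift unfolding converges_to_1_def by metis
  qed
qed

text \<open>Each factor 2 is removed by one halving step of the sequence.\<close>

lemma converges_to_1_collatz_power_two_mult:
  "converges_to_1 (collatz (2 ^ k * A)) \<longleftrightarrow> converges_to_1 (collatz A)"
proof (induction k)
  case (Suc k)
  then show ?case
    using converges_to_1_collatz_step [of "2 ^ Suc k * A"] by (simp add: mult.assoc)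
qed simp

lemma ex_power_two_mult_mod_9:
  fixes A :: nat
  assumes "\<not> 3 dvd A"
  shows "\<exists>k\<ge>1. 2 ^ k * A mod 9 = 1"
proof -
  \<comment> \<open>The residues are listed as the inverses modulo 9 of \<open>2 ^ 1\<close>, ...,
    \<open>2 ^ 6\<close>, so the disjuncts match those below in order.\<close>
  have "A mod 9 = 5 \<or> A mod 9 = 7 \<or> A mod 9 = 8 \<or> A mod 9 = 4 \<or> A mod 9 = 2 \<or> A mod 9 = 1"
    using assms by presburger
  then have "2 ^ 1 * A mod 9 = 1 \<or> 2 ^ 2 * A mod 9 = 1 \<or> 2 ^ 3 * A mod 9 = 1 \<or>
      2 ^ 4 * A mod 9 = 1 \<or> 2 ^ 5 * A mod 9 = 1 \<or> 2 ^ 6 * A mod 9 = 1"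
    by (elim disjE) (simp_all add: mod_mult_right_eq [of _ A 9, symmetric])
  then show ?thesis
    by (elim disjE) (rule exI, rule conjI [rotated], assumption, simp)+
qed

theorem mainTheorem1:
  assumes "\<forall>A :: nat. A > 0 \<and> odd A \<and> 3 dvd A \<longrightarrow> converges_to_1 (collatz A)"
  shows "\<forall>A :: nat. A > 0 \<longrightarrow> converges_to_1 (collatz A)"
proof (intro allI impI)
  fix A :: nat
  assume "A > 0"
  show "converges_to_1 (collatz A)"
  proof (cases "3 dvd A")
    case True
    with \<open>A > 0\<close> show ?thesis
    proof (induction A rule: less_induct)
      case (less A)
      show ?case
      proof (cases "even A")
        case True
        then obtain n where n: "A = 2 * n" by blast
        \<comment> \<open>Halving preserves divisibility by 3, as 2 and 3 are coprime.\<close>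
        with less.prems have "n < A" "n > 0" "3 dvd n"
          by presburger+
        with less.IH have "converges_to_1 (collatz n)"
          by blast
        with n show ?thesis
          using converges_to_1_collatz_power_two_mult [of 1 n] by simp
      next
        case False
        with less.prems assms show ?thesis by blast
      qed
    qed
  next
    case False
    then obtain k where "k \<ge> 1" and k: "2 ^ k * A mod 9 = 1"
      using ex_power_two_mult_mod_9 by blast
    define q where "q = 2 ^ k * A div 9"
    have q: "2 ^ k * A = 9 * q + 1"
      unfolding q_def using k by presburger
    have "even (2 ^ k * A)"
      using \<open>k \<ge> 1\<close> by simp
    with q have "odd q"
      by simp
    \<comment> \<open>Being odd, \<open>q\<close> is nonzero, so \<open>3 * q\<close> is
      positive.\<close>
    with assms have "converges_to_1 (collatz (3 * q))"
      by (simp add: odd_pos)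
    moreover have "collatz (3 * q) 1 = 2 ^ k * A"
      using \<open>odd q\<close> q by simp
    \<comment> \<open>Convergence passes from \<open>3 * q\<close> to its successor
      \<open>2 ^ k * A\<close>, and then to \<open>A\<close> by stripping
      \<open>2 ^ k\<close>.\<close>
    ultimately show ?thesis
      by (metis converges_to_1_collatz_step converges_to_1_collatz_power_two_mult)
  qed
qed

end
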